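(* Suppose $J\neq m_L$. For every $l\in\mathcal{J}$, every $\beta'\in\mathbb{F}_{q^J}$ and every full rank matrix $\mathbf{V}\in\mathbb{F}_q^{J\times J}$, $$\mathbf{G}_L\mathbf{C}_L^{l}\mathbf{H}_L\neq\mathbf{V}\mathbf{A}(\beta')\mathbf{V}^{-1}.$$
   Context: Setting. $q$ is a prime, $L$ is a positive integer with $\gcd(q,L)=1$, $m_L$ is the multiplicative order of $q$ modulo $L$, $\mathcal{J}=\{j:1\le j\le L-1,\ \gcd(j,L)=1\}$, $J=|\mathcal{J}|$, and $m_L\le J$ (automatic for $L\ge 2$). $L_{\mathbb{F}_q}=L \bmod q$ is regarded as a nonzero element of $\mathbb{F}_q$. $\beta\in\mathbb{F}_{q^{m_L}}$ is a primitive $L$-th root of unity. $\mathbf{C}_L=\begin{bmatrix}\mathbf{0}&\mathbf{I}_{L-1}\\1&\mathbf{0}\end{bmatrix}$ is the $L\times L$ cyclic permutation matrix over $\mathbb{F}_q$. $\mathbf{V}_L=[\beta^{ij}]_{0\le i,j\le L-1}$ and $\widetilde{\mathbf{V}}_L=[\beta^{-ij}]_{0\le i,j\le L-1}$. $[\mathbf{x}_j]_{j\in\mathcal{J}}$ denotes juxtaposition of columns in increasing order of $j$; $j\notin\mathcal J$ means $0\le j\le L-1$, $j\notin\mathcal{J}$. $\mathbf{U}=[\mathbf{u}_j]_{0\le j\le L-1}$ and $\mathbf{U}'=[\mathbf{u}'_j]_{0\le j\le L-1}$ are matrices in $\mathbb{F}_{q^{m_L}}^{J\times L}$ (columns indexed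 from $0$) satisfying: $\mathrm{rank}([\mathbf{u}_j]_{j\in\mathcal{J}})=J$; $[\mathbf{u}'_j]_{j\in\mathcal{J}}^{\mathrm T}=L_{\mathbb{F}_q}^{-1}[\mathbf{u}_j]_{j\in\mathcal{J}}^{-1}$; and $[\mathbf{u}_j]_{j\notin\mathcal{J}}=\mathbf{0}$ or $[\mathbf{u}'_j]_{j\notin\mathcal{J}}=\mathbf{0}$. Put $\mathbf{G}_L=\mathbf{U}\widetilde{\mathbf{V}}_L$ ($J\times L$) and $\mathbf{H}_L=\mathbf{V}_L\mathbf{U}'^{\mathrm T}$ ($L\times J$); it is assumed that both have all entries in $\mathbb{F}_q$. Matrix representation of $\mathbb{F}_{q^J}$. Let $p(x)=p_0+p_1x+\cdots+p_{J-1}x^{J-1}+x^J$ be an arbitrary irreducible polynomial of degree $J$ over $\mathbb{F}_q$ with root $\gamma\in\mathbb{F}_{q^J}$. Let $\mathbf{A}(\gamma)\in\mathbb{F}_q^{J\times J}$ be the matrix whose first row is $[-p_{J-1}~-p_{J-2}~\ldots~-p_0]$ and whose $i$-th row, $2\le i\le J$, has a $1$ in column $i-1$ and zeros elsewhere. For $\beta'=\sum_{i=0}^{J-1}a_i\gamma^i$ with $a_i\in\mathbb{F}_q$, put $\mathbf{A}(\beta')=\sum_{i=0}^{J-1}a_i\mathbf{A}(\gamma)^i$. *)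

theory Defs
  imports
    "HOL-Library.Cardinality"
    "Jordan_Normal_Form.DL_Rank"
    "Jordan_Normal_Form.DL_Submatrix"
    "Jordan_Normal_Form.Gauss_Jordan_Elimination"
    "Jordan_Normal_Form.Char_Poly"
    "HOL-Number_Theory.Number_Theory"
begin

text \<open>
  A finite field is a type of class \<open>{field, finite}\<close>, determined up to isomorphism by its
  cardinality. The inclusion of the base field into an extension field is an arbitrary
  (automatically injective) field homomorphism.
\<close>

definition coprime_exponents :: "nat \<Rightarrow> nat set" where
  "coprime_exponents L = {j. 1 \<le> j \<and> j \<le> L - 1 \<and> coprime j L}"

definition primitive_root_of_unity :: "nat \<Rightarrow> 'a::field \<Rightarrow> bool" where
  "primitive_root_of_unity n z \<longleftrightarrow> 0 < n \<and> z ^ n = 1 \<and> (\<forall>k. 0 < k \<and> k < n \<longrightarrow> z ^ k \<noteq> 1)"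

definition cyclic_perm_mat :: "nat \<Rightarrow> 'a::field mat" where
  "cyclic_perm_mat L =
     four_block_mat (0\<^sub>m (L - 1) 1) (1\<^sub>m (L - 1))
                    (1\<^sub>m 1)         (0\<^sub>m 1 (L - 1))"

definition fourier_mat :: "nat \<Rightarrow> 'a::field \<Rightarrow> 'a mat" where
  "fourier_mat L b = mat L L (\<lambda>(i, j). b ^ (i * j))"

definition fourier_mat_neg :: "nat \<Rightarrow> 'a::field \<Rightarrow> 'a mat" where
  "fourier_mat_neg L b = mat L L (\<lambda>(i, j). inverse (b ^ (i * j)))"

definition columns_at :: "'a mat \<Rightarrow> nat set \<Rightarrow> 'a mat" where
  "columns_at A S = submatrix A UNIV S"

text \<open>Only meaningful for invertible square matrices.\<close>

definition inverse_mat :: "'a::field mat \<Rightarrow> 'a mat" where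
  "inverse_mat A = the (mat_inverse A)"

text \<open>
  Rows and columns are numbered from 0 here, so entry \<open>(0, j)\<close> is minus the coefficient
  of degree \<open>n - 1 - j\<close>.
\<close>

definition generator_mat :: "'a::field poly \<Rightarrow> 'a mat" where
  "generator_mat p =
     (let n = degree p in
      mat n n (\<lambda>(i, j). if i = 0 then - Polynomial.coeff p (n - 1 - j) else if j = i - 1 then 1 else 0))"

text \<open>
  The coordinates of \<open>x\<close> with respect to \<open>1, g, \<dots>, g ^ (n - 1)\<close> over the image of \<open>h\<close>,
  continued by 0 so that they are unique as a function on the natural numbers.
\<close>

definition is_power_coords :: "('a::field \<Rightarrow> 'b::field) \<Rightarrow> nat \<Rightarrow> 'b \<Rightarrow> 'b \<Rightarrow> (nat \<Rightarrow> 'a) \<Rightarrow> bool" where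
  "is_power_coords h n g x a \<longleftrightarrow> (\<forall>i\<ge>n. a i = 0) \<and> x = (\<Sum>i<n. h (a i) * g ^ i)"

definition power_coords :: "('a::field \<Rightarrow> 'b::field) \<Rightarrow> nat \<Rightarrow> 'b \<Rightarrow> 'b \<Rightarrow> nat \<Rightarrow> 'a" where
  "power_coords h n g x = (THE a. is_power_coords h n g x a)"

text \<open>The coordinates exist and are unique, so the definite description above is well defined.\<close>

lemma power_coords_unique:
  fixes \<kappa> :: "'f::{field,finite} \<Rightarrow> 'k::{field,finite}" and p :: "'f poly"
  assumes "field_hom \<kappa>" and irr: "irreducible p" and deg: "degree p = n"
    and root: "poly (map_poly \<kappa> p) \<gamma> = 0" and card: "CARD('k) = CARD('f) ^ n"
  shows "\<exists>!a. is_power_coords \<kappa> n \<gamma> x a"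
proof -
  interpret h: field_hom \<kappa> by fact
  interpret m: map_poly_comm_ring_hom \<kappa> ..
  define ev where "ev = (\<lambda>r. poly (map_poly \<kappa> r) \<gamma>)"
  define C where "C = {a :: nat \<Rightarrow> 'f. \<forall>i\<ge>n. a i = 0}"
  define S where "S = (\<lambda>a :: nat \<Rightarrow> 'f. \<Sum>i<n. \<kappa> (a i) * \<gamma> ^ i)"
  have nz: "r = 0" if "ev r = 0" "degree r < n" for r :: "'f poly"
  proof (rule ccontr)
    assume r0: "r \<noteq> 0"
    define d where "d = (ARG_MIN degree s. s \<noteq> 0 \<and> ev s = 0)"
    have p0: "p \<noteq> 0" using irr by auto
    have dd: "d \<noteq> 0" "ev d = 0" "\<And>s. s \<noteq> 0 \<Longrightarrow> ev s = 0 \<Longrightarrow> degree d \<le> degree s"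
      using arg_min_nat_lemma[of "\<lambda>s. s \<noteq> 0 \<and> ev s = 0" r degree] r0 that(1)
      unfolding d_def by auto
    have "ev p = ev (d * (p div d) + p mod d)" by simp
    also have "\<dots> = ev d * ev (p div d) + ev (p mod d)"
      unfolding ev_def by (simp only: m.hom_add m.hom_mult poly_add poly_mult)
    finally have "ev (p mod d) = 0" using root dd(2) by (simp add: ev_def)
    then have "p mod d = 0"
      using dd(1) dd(3)[of "p mod d"] degree_mod_less[of d p] by fastforce
    then have "d dvd p" by auto
    then obtain e where e: "p = d * e" unfolding dvd_def by blast
    from Factorial_Ring.irreducibleD[OF irr e] show False
    proof
      assume "is_unit d"
      then obtain c where "d = [:c:]" "c \<noteq> 0" using dd(1)
        by (metis degree_eq_zeroE is_unit_iff_degree pCons_0_0)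
      then show False using dd(2) by (simp add: ev_def)
    next
      assume "is_unit e"
      then have "degree e = 0" by (auto simp: is_unit_poly_iff)
      moreover have "degree p = degree d + degree e"
        using e p0 by (auto intro: degree_mult_eq)
      ultimately show False using dd(3)[OF r0 that(1)] that(2) deg by simp
    qed
  qed
  have S_ev: "S a = ev (\<Sum>i<n. Polynomial.monom (a i) i)" for a
    unfolding S_def ev_def by (simp add: m.hom_sum poly_sum poly_monom)
  have "inj_on S C"
  proof (rule inj_onI)
    fix a b assume ab: "a \<in> C" "b \<in> C" "S a = S b"
    define r where "r = (\<Sum>i<n. Polynomial.monom (a i - b i) i)"
    have "S (\<lambda>i. a i - b i) = S a - S b"
      by (simp add: S_def h.hom_minus algebra_simps sum_subtractf)
    then have "ev r = 0" using ab(3) S_ev[of "\<lambda>i. a i - b i"] by (simp add: r_def)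
    have npos: "0 < n"
    proof (rule ccontr)
      assume "\<not> 0 < n"
      then have "degree p = 0" using deg by simp
      then show False using irr is_unit_iff_degree[of p] by (auto simp: Factorial_Ring.irreducible_def)
    qed
    have cr: "Polynomial.coeff r i = (if i < n then a i - b i else 0)" for i
      by (simp add: r_def coeff_sum)
    have "degree r \<le> n - 1" using cr by (intro degree_le) auto
    then have "degree r < n" using npos by simp
    then have "r = 0" using nz \<open>ev r = 0\<close> by blast
    show "a = b"
    proof
      fix i show "a i = b i"
        using cr[of i] \<open>r = 0\<close> ab(1,2) by (cases "i < n") (auto simp: C_def)
    qed
  qed
  have C_PiE: "C = (\<lambda>f i. if i < n then f i else 0) ` ({..<n} \<rightarrow>\<^sub>E UNIV)"
  proof
    show "C \<subseteq> (\<lambda>f i. if i < n then f i else 0) ` ({..<n} \<rightarrow>\<^sub>E UNIV)"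
    proof
      fix a assume "a \<in> C"
      then have "a = (\<lambda>i. if i < n then restrict a {..<n} i else 0)"
        by (auto simp: C_def fun_eq_iff)
      then show "a \<in> (\<lambda>f i. if i < n then f i else 0) ` ({..<n} \<rightarrow>\<^sub>E UNIV)"
        by (intro image_eqI[of _ _ "restrict a {..<n}"]) auto
    qed
    show "(\<lambda>f i. if i < n then f i else 0) ` ({..<n} \<rightarrow>\<^sub>E UNIV) \<subseteq> C"
      unfolding C_def by (rule image_subsetI) simp
  qed
  have "inj_on (\<lambda>f i. if i < n then f i else (0::'f)) ({..<n} \<rightarrow>\<^sub>E UNIV)"
  proof (rule inj_onI)
    fix f g :: "nat \<Rightarrow> 'f"
    assume fg: "f \<in> {..<n} \<rightarrow>\<^sub>E UNIV" "g \<in> {..<n} \<rightarrow>\<^sub>E UNIV"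
      and eq: "(\<lambda>i. if i < n then f i else 0) = (\<lambda>i. if i < n then g i else 0)"
    have "f i = g i" if "i < n" for i using fun_cong[OF eq, of i] that by simp
    then show "f = g" using fg by (intro PiE_ext[of f "{..<n}" "\<lambda>_. UNIV" g]) auto
  qed
  then have "card C = CARD('f) ^ n"
    by (simp add: C_PiE card_image card_PiE)
  then have "card (S ` C) = CARD('k)"
    using card card_image[OF \<open>inj_on S C\<close>] by simp
  then have "S ` C = UNIV" by (intro card_subset_eq[OF finite subset_UNIV])
  then obtain a where a: "a \<in> C" "x = S a" by blast
  have iff: "is_power_coords \<kappa> n \<gamma> x b \<longleftrightarrow> b \<in> C \<and> x = S b" for b
    by (simp add: is_power_coords_def C_def S_def)
  show ?thesis
    unfolding iff using a \<open>inj_on S C\<close> by (blast dest: inj_onD)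
qed

text \<open>
  The sum of the matrices \<open>a i \<cdot>\<^sub>m A ^\<^sub>m i\<close> is written entrywise because the matrix type,
  which includes matrices of all sizes, has no big sum operator.
\<close>

definition field_elem_mat :: "('a::field \<Rightarrow> 'b::field) \<Rightarrow> 'a poly \<Rightarrow> 'b \<Rightarrow> 'b \<Rightarrow> 'a mat" where
  "field_elem_mat h p g x =
     (let n = degree p; a = power_coords h n g x in
      mat n n (\<lambda>(r, c). \<Sum>i<n. a i * (generator_mat p ^\<^sub>m i) $$ (r, c)))"

end

theory Submission
  imports Defs
begin

text \<open>
  The product \<open>M = G C\<^sup>l H\<close> is \<open>U\<close> times a diagonal matrix times the transpose of \<open>U'\<close>, so each
  column \<open>u\<^sub>j\<close> of \<open>U\<close> with \<open>j \<in> \<J>\<close> is an eigenvector of \<open>M\<close> for \<open>\<beta>\<close> to the power \<open>l j\<close>; these are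
  \<open>J\<close> distinct eigenvalues in a field of degree \<open>m\<close> over the base field. If \<open>M\<close> were conjugate
  to the matrix of a field element, then the algebra generated by \<open>M\<close> would be a field: a nonzero
  polynomial \<open>g\<close> of degree at most \<open>m\<close> annihilating one of these eigenvalues makes \<open>g(M)\<close> singular,
  hence 0, so that \<open>g\<close> annihilates all \<open>J\<close> of them and \<open>J \<le> m\<close>. That \<open>g(M)\<close> is 0 or invertible is
  seen from the eigenvector \<open>(\<gamma>\<^bsup>J-1\<^esup>, \<dots>, \<gamma>, 1)\<close> of the companion matrix, whose entries are
  linearly independent over the base field.
\<close>

section \<open>Polynomials in a matrix and their eigenvectors over an extension field\<close>

text \<open>The value at \<open>A\<close> of the polynomial with coefficients
  \<open>a 0, ..., a (N - 1)\<close>. The entrywise form is that of \<open>field_elem_mat\<close>,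
  so one eigenvector lemma serves both field elements and annihilating polynomials.\<close>

definition pow_comb :: "nat \<Rightarrow> (nat \<Rightarrow> 'a::comm_semiring_1) \<Rightarrow> 'a mat \<Rightarrow> 'a mat" where
  "pow_comb N a A =
     mat (dim_row A) (dim_row A) (\<lambda>(r, c). \<Sum>i<N. a i * (A ^\<^sub>m i) $$ (r, c))"

lemma pow_comb_carrier [simp]: "A \<in> carrier_mat n n \<Longrightarrow> pow_comb N a A \<in> carrier_mat n n"
  by (simp add: pow_comb_def)

lemma smult_0_vec: "v \<in> carrier_vec n \<Longrightarrow> 0 \<cdot>\<^sub>v v = (0\<^sub>v n :: 'a::semiring_0 vec)"
  by (intro eq_vecI) auto

lemma pow_mat_eigenvector:
  fixes A :: "'a::field mat"
  assumes A: "A \<in> carrier_mat n n" and z: "z \<in> carrier_vec n" and ev: "A *\<^sub>v z = x \<cdot>\<^sub>v z"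
  shows "(A ^\<^sub>m i) *\<^sub>v z = x ^ i \<cdot>\<^sub>v z"
proof (induction i)
  case 0
  show ?case using A z by simp
next
  case (Suc i)
  have "(A ^\<^sub>m Suc i) *\<^sub>v z = (A ^\<^sub>m i) *\<^sub>v (A *\<^sub>v z)"
    using assoc_mult_mat_vec[OF pow_carrier_mat[OF A] A z] by simp
  also have "\<dots> = x \<cdot>\<^sub>v ((A ^\<^sub>m i) *\<^sub>v z)"
    using A z ev by (simp add: mult_mat_vec[of _ n n])
  finally show ?case by (simp add: Suc.IH smult_smult_assoc)
qed

text \<open>The matrix and the coefficients lie in the base field, while \<open>z\<close> and
  \<open>x\<close> lie in the extension. Each power of \<open>A\<close> scales \<open>z\<close> by
  the same power of \<open>x\<close>; interchanging the sums over \<open>i\<close> and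
  \<open>c\<close> gives the claim.\<close>

lemma (in field_hom) pow_comb_eigenvector:
  assumes A: "A \<in> carrier_mat n n" and z: "z \<in> carrier_vec n"
    and ev: "mat\<^sub>h A *\<^sub>v z = x \<cdot>\<^sub>v z"
  shows "mat\<^sub>h (pow_comb N a A) *\<^sub>v z = (\<Sum>i<N. hom (a i) * x ^ i) \<cdot>\<^sub>v z"
proof (rule eq_vecI)
  fix r assume "r < dim_vec ((\<Sum>i<N. hom (a i) * x ^ i) \<cdot>\<^sub>v z)"
  then have r: "r < n" using z by simp
  have pow: "(\<Sum>c<n. hom ((A ^\<^sub>m i) $$ (r, c)) * z $ c) = x ^ i * z $ r" for i
  proof -
    have "x ^ i * z $ r = ((mat\<^sub>h A ^\<^sub>m i) *\<^sub>v z) $ r"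
      using pow_mat_eigenvector[OF _ z ev, of i] A z r by simp
    also have "\<dots> = (mat\<^sub>h (A ^\<^sub>m i) *\<^sub>v z) $ r"
      using A by (simp add: mat_hom_pow)
    also have "\<dots> = (\<Sum>c<n. hom ((A ^\<^sub>m i) $$ (r, c)) * z $ c)"
      using A z r by (simp add: scalar_prod_def atLeast0LessThan)
    finally show ?thesis ..
  qed
  have "(mat\<^sub>h (pow_comb N a A) *\<^sub>v z) $ r
      = (\<Sum>c<n. (\<Sum>i<N. hom (a i) * hom ((A ^\<^sub>m i) $$ (r, c))) * z $ c)"
    using A z r
    by (simp add: pow_comb_def scalar_prod_def atLeast0LessThan hom_sum hom_mult)
  also have "\<dots> = (\<Sum>i<N. hom (a i) * (\<Sum>c<n. hom ((A ^\<^sub>m i) $$ (r, c)) * z $ c))"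
    by (simp add: sum_distrib_left sum_distrib_right mult.assoc) (rule sum.swap)
  also have "\<dots> = ((\<Sum>i<N. hom (a i) * x ^ i) \<cdot>\<^sub>v z) $ r"
    using z r by (simp add: pow sum_distrib_right mult.assoc)
  finally show "(mat\<^sub>h (pow_comb N a A) *\<^sub>v z) $ r = ((\<Sum>i<N. hom (a i) * x ^ i) \<cdot>\<^sub>v z) $ r" .
qed (use A z in \<open>simp add: pow_comb_def\<close>)

section \<open>Eigenvectors whose entries are linearly independent over the base field\<close>

text \<open>Linear independence over the image of \<open>h\<close>. A relation is a vector
  \<open>v\<close> over the base field, so that rows and left kernel vectors of base field matrices
  can be inserted directly.\<close>

definition indep_entries :: "('a::field \<Rightarrow> 'b::field) \<Rightarrow> nat \<Rightarrow> 'b vec \<Rightarrow> bool" where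
  "indep_entries h n w \<longleftrightarrow>
     w \<in> carrier_vec n \<and> (\<forall>v\<in>carrier_vec n. map_vec h v \<bullet> w = 0 \<longrightarrow> v = 0\<^sub>v n)"

text \<open>A relation \<open>v\<close> among the entries of \<open>V w\<close> becomes the relation
  given by transposed \<open>V\<close> times \<open>v\<close> among the entries of \<open>w\<close>.
  Transposed \<open>V\<close> is injective, because transposed \<open>W\<close> is a left inverse of
  it.\<close>

lemma (in field_hom) indep_entries_mult:
  assumes V: "V \<in> carrier_mat n n" and W: "W \<in> carrier_mat n n" "V * W = 1\<^sub>m n"
    and w: "indep_entries hom n w"
  shows "indep_entries hom n (mat\<^sub>h V *\<^sub>v w)"
  unfolding indep_entries_def
proof (intro conjI ballI impI)
  have wc: "w \<in> carrier_vec n" using w by (simp add: indep_entries_def)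
  then show "mat\<^sub>h V *\<^sub>v w \<in> carrier_vec n" using V by simp
  fix v assume v: "v \<in> carrier_vec n" and z: "vec\<^sub>h v \<bullet> (mat\<^sub>h V *\<^sub>v w) = 0"
  have "vec\<^sub>h (V\<^sup>T *\<^sub>v v) = (mat\<^sub>h V)\<^sup>T *\<^sub>v vec\<^sub>h v"
    using V v by (simp add: mult_mat_vec_hom[of _ n n] map_mat_transpose)
  then have "vec\<^sub>h (V\<^sup>T *\<^sub>v v) \<bullet> w = 0"
    using transpose_vec_mult_scalar[of "mat\<^sub>h V" n n w "vec\<^sub>h v"] V v wc z by simp
  then have "V\<^sup>T *\<^sub>v v = 0\<^sub>v n"
    using w V v by (auto simp: indep_entries_def)
  then have "(W\<^sup>T * V\<^sup>T) *\<^sub>v v = 0\<^sub>v n"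
    using V W(1) v by (auto simp: assoc_mult_mat_vec[of _ n n _ n])
  moreover have "W\<^sup>T * V\<^sup>T = 1\<^sub>m n"
    using transpose_mult[OF V W(1)] W(2) by simp
  ultimately show "v = 0\<^sub>v n" using v by simp
qed

text \<open>A left kernel vector of \<open>P\<close> forces \<open>c = 0\<close>, and then every row of \<open>P\<close> annihilates \<open>w\<close>.\<close>

lemma (in field_hom) singular_indep_eigenvector:
  assumes P: "P \<in> carrier_mat n n" and det: "det P = 0"
    and w: "indep_entries hom n w" and ev: "mat\<^sub>h P *\<^sub>v w = c \<cdot>\<^sub>v w"
  shows "P = 0\<^sub>m n n"
proof -
  have wc: "w \<in> carrier_vec n" using w by (simp add: indep_entries_def)
  have "det (P\<^sup>T) = 0" using P det by (simp add: det_transpose)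
  then obtain v where v: "v \<in> carrier_vec n" "v \<noteq> 0\<^sub>v n" "P\<^sup>T *\<^sub>v v = 0\<^sub>v n"
    using det_0_iff_vec_prod_zero_field[of "P\<^sup>T" n] P by auto
  have "vec\<^sub>h v \<bullet> w \<noteq> 0" using w v by (auto simp: indep_entries_def)
  have "(mat\<^sub>h P)\<^sup>T *\<^sub>v vec\<^sub>h v = vec\<^sub>h (P\<^sup>T *\<^sub>v v)"
    using P v(1) by (simp add: mult_mat_vec_hom[of _ n n] map_mat_transpose)
  also have "\<dots> = 0\<^sub>v n" by (simp add: v vec_hom_zero)
  finally have "vec\<^sub>h v \<bullet> (mat\<^sub>h P *\<^sub>v w) = 0"
    using transpose_vec_mult_scalar[of "mat\<^sub>h P" n n w "vec\<^sub>h v"] P v(1) wc by simp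
  then have "c * (vec\<^sub>h v \<bullet> w) = 0" using v wc by (simp add: ev)
  with \<open>vec\<^sub>h v \<bullet> w \<noteq> 0\<close> have "c = 0" by simp
  have "row P i = 0\<^sub>v n" if "i < n" for i
  proof -
    have "vec\<^sub>h (row P i) \<bullet> w = (mat\<^sub>h P *\<^sub>v w) $ i"
      using P that wc by (simp add: scalar_prod_def)
    also have "\<dots> = 0" using wc that by (simp add: ev \<open>c = 0\<close>)
    finally show ?thesis using w P that by (auto simp: indep_entries_def)
  qed
  then show ?thesis
    using P by (intro eq_rowI) auto
qed

section \<open>Annihilating polynomials and the bound on the number of eigenvalues\<close>

text \<open>Pigeonhole principle: there are more tuples of \<open>m + 1\<close> coefficients than
  elements of \<open>'b\<close>. Two tuples with the same value at \<open>x\<close> have the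
  required difference.\<close>

lemma ex_annihilator_le_degree:
  fixes h :: "'a::{field,finite} \<Rightarrow> 'b::{field,finite}"
  assumes "field_hom h" and card: "CARD('b) = CARD('a) ^ m"
  shows "\<exists>a. (\<Sum>i<Suc m. h (a i) * x ^ i) = 0 \<and> (\<exists>i<Suc m. a i \<noteq> 0)"
proof -
  interpret h: field_hom h by fact
  define C where "C = ({..<Suc m} \<rightarrow>\<^sub>E (UNIV :: 'a set))"
  define ev where "ev = (\<lambda>a. \<Sum>i<Suc m. h (a i) * x ^ i)"
  \<comment> \<open>Strictness comes from the two distinct elements 0 and 1 of the base
    field.\<close>
  have "CARD('a) ^ m < card C"
    using finite_UNIV_card_ge_0[where ?'a = 'a] card_mono[of UNIV "{0, 1 :: 'a}"]
    by (simp add: C_def card_PiE)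
  moreover have "card (ev ` C) \<le> CARD('b)" by (rule card_mono) auto
  ultimately have "\<not> inj_on ev C" using card by (metis card_image not_less)
  then obtain a b where ab: "a \<in> C" "b \<in> C" "a \<noteq> b" "ev a = ev b"
    by (auto simp: inj_on_def)
  have "\<exists>i<Suc m. a i \<noteq> b i"
    using ab(1-3) PiE_ext[of a "{..<Suc m}" "\<lambda>_. UNIV" b] by (auto simp: C_def)
  moreover have "(\<Sum>i<Suc m. h (a i - b i) * x ^ i) = 0"
    using ab(4) by (simp add: ev_def h.hom_minus algebra_simps sum_subtractf sum.distrib)
  ultimately show ?thesis by (intro exI[of _ "\<lambda>i. a i - b i"]) auto
qed

text \<open>The base field matrix \<open>M\<close> is viewed in two unrelated extensions: the
  eigenvalues \<open>S\<close> lie in \<open>'e\<close>, the entries of \<open>w\<close> in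
  \<open>'k\<close>. A polynomial in \<open>M\<close> is found singular through \<open>h\<close> and
  hence zero through \<open>k\<close>.\<close>

lemma card_eigenvalues_le:
  fixes h :: "'f::{field,finite} \<Rightarrow> 'e::{field,finite}" and k :: "'f \<Rightarrow> 'k::field"
  assumes h: "field_hom h" and k: "field_hom k"
    and card: "CARD('e) = CARD('f) ^ m"
    and M: "M \<in> carrier_mat n n"
    and w: "indep_entries k n w" "map_mat k M *\<^sub>v w = b \<cdot>\<^sub>v w"
    and S: "\<And>s. s \<in> S \<Longrightarrow> eigenvalue (map_mat h M) s"
  shows "card S \<le> m"
proof (cases "S = {}")
  case False
  interpret h: field_hom h by fact
  interpret k: field_hom k by fact
  from False obtain s where s: "s \<in> S" by auto
  obtain a i where a: "(\<Sum>i<Suc m. h (a i) * s ^ i) = 0" "i < Suc m" "a i \<noteq> 0"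
    using ex_annihilator_le_degree[OF h card] by blast
  define P where "P = pow_comb (Suc m) a M"
  have P: "P \<in> carrier_mat n n" using M by (simp add: P_def)
  have eig: "\<exists>z. z \<in> carrier_vec n \<and> z \<noteq> 0\<^sub>v n \<and>
      map_mat h P *\<^sub>v z = (\<Sum>i<Suc m. h (a i) * t ^ i) \<cdot>\<^sub>v z" if t: "t \<in> S" for t
    using S[OF t] M h.pow_comb_eigenvector[OF M]
    unfolding eigenvalue_def eigenvector_def P_def by auto
  from eig[OF s] obtain z where z: "z \<in> carrier_vec n" "z \<noteq> 0\<^sub>v n" "map_mat h P *\<^sub>v z = 0 \<cdot>\<^sub>v z"
    unfolding a(1) by blast
  then have "det (map_mat h P) = 0"
    using det_0_iff_vec_prod_zero_field[of "map_mat h P" n] P by (auto simp: smult_0_vec)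
  \<comment> \<open>The determinant commutes with the injective \<open>h\<close>, so singularity
    descends to the base field, where \<open>k\<close> can take over.\<close>
  then have "det P = 0" by simp
  moreover have "map_mat k P *\<^sub>v w = (\<Sum>i<Suc m. k (a i) * b ^ i) \<cdot>\<^sub>v w"
    unfolding P_def using M w by (intro k.pow_comb_eigenvector) (auto simp: indep_entries_def)
  ultimately have P0: "P = 0\<^sub>m n n"
    using k.singular_indep_eigenvector[OF P _ w(1)] by blast
  \<comment> \<open>The annihilator of \<open>s\<close> is read as a polynomial over
    \<open>'e\<close>, where its roots can be counted.\<close>
  define g where "g = (\<Sum>i<Suc m. Polynomial.monom (h (a i)) i)"
  have root: "poly g t = 0" if t: "t \<in> S" for t
  proof -
    obtain z where z: "z \<in> carrier_vec n" "z \<noteq> 0\<^sub>v n"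
      "map_mat h P *\<^sub>v z = (\<Sum>i<Suc m. h (a i) * t ^ i) \<cdot>\<^sub>v z"
      using eig[OF t] by blast
    have "map_mat h P *\<^sub>v z = 0\<^sub>v n"
      using z(1) by (intro eq_vecI) (auto simp: P0 scalar_prod_def)
    then have "(\<Sum>i<Suc m. h (a i) * t ^ i) \<cdot>\<^sub>v z = 0\<^sub>v n" using z(3) by simp
    moreover obtain j where "j < n" "z $ j \<noteq> 0" using z(1,2) by (auto simp: vec_eq_iff)
    ultimately have "(\<Sum>i<Suc m. h (a i) * t ^ i) = 0"
      using z(1) by (metis (no_types, lifting) carrier_vecD index_smult_vec(1) index_zero_vec(1)
          mult_eq_0_iff)
    then show ?thesis by (simp add: g_def poly_sum poly_monom)
  qed
  have cg: "Polynomial.coeff g j = (if j < Suc m then h (a j) else 0)" for j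
    by (simp add: g_def coeff_sum del: sum.lessThan_Suc)
  have "Polynomial.coeff g i \<noteq> 0" using a(2,3) by (simp add: cg)
  then have "g \<noteq> 0" by auto
  then have "card S \<le> degree g"
    using root card_mono[of "{x. poly g x = 0}" S] card_poly_roots_bound[of g]
      poly_roots_finite[of g] by fastforce
  also have "\<dots> \<le> m" by (rule degree_le) (simp add: cg)
  finally show ?thesis .
qed simp

section \<open>Inverses of full rank matrices and the companion matrix\<close>

text \<open>The determinant is nonzero, so \<open>mat_inverse\<close> returns \<open>Some\<close>
  and the \<open>the\<close> inside \<open>inverse_mat\<close> is meaningful.\<close>

lemma inverse_mat_full_rank:
  fixes A :: "'a::field mat"
  assumes A: "A \<in> carrier_mat n n" and rank: "vec_space.rank n A = n"
  shows "inverse_mat A \<in> carrier_mat n n" "inverse_mat A * A = 1\<^sub>m n" "A * inverse_mat A = 1\<^sub>m n"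
proof -
  have "det A \<noteq> 0" using vec_space.det_rank_iff[OF A] rank by blast
  \<comment> \<open>Both facts about units leave the parameter \<open>b\<close> of the matrix ring
    free; fixing it to \<open>()\<close> makes them speak of the same ring.\<close>
  then obtain B where "mat_inverse A = Some B"
    using mat_inverse(1)[OF A, where b = "()"] det_non_zero_imp_unit[OF A, where b = "()"]
    by (cases "mat_inverse A") auto
  then show "inverse_mat A \<in> carrier_mat n n" "inverse_mat A * A = 1\<^sub>m n" "A * inverse_mat A = 1\<^sub>m n"
    using mat_inverse(2)[OF A] by (auto simp: inverse_mat_def)
qed

text \<open>On the descending powers of \<open>g\<close>, the first row evaluates to
  \<open>g ^ degree p\<close> by the equation \<open>p(g) = 0\<close>, and every other row picks the
  preceding entry, which is \<open>g\<close> times its own.\<close>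

lemma generator_mat_eigenvector:
  assumes k: "field_hom k" and monic: "lead_coeff p = 1" and root: "poly (map_poly k p) g = 0"
  shows "map_mat k (generator_mat p) *\<^sub>v vec (degree p) (\<lambda>i. g ^ (degree p - 1 - i))
           = g \<cdot>\<^sub>v vec (degree p) (\<lambda>i. g ^ (degree p - 1 - i))"
proof (rule eq_vecI)
  interpret k: field_hom k by fact
  let ?n = "degree p" and ?w = "vec (degree p) (\<lambda>i. g ^ (degree p - 1 - i))"
  fix r assume "r < dim_vec (g \<cdot>\<^sub>v ?w)"
  then have r: "r < ?n" by simp
  have val: "(map_mat k (generator_mat p) *\<^sub>v ?w) $ r
      = (\<Sum>j<?n. k (generator_mat p $$ (r, j)) * g ^ (?n - 1 - j))"
    using r by (simp add: generator_mat_def Let_def scalar_prod_def atLeast0LessThan)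
  show "(map_mat k (generator_mat p) *\<^sub>v ?w) $ r = (g \<cdot>\<^sub>v ?w) $ r"
  proof (cases "r = 0")
    case True
    have "0 = (\<Sum>i\<le>?n. k (Polynomial.coeff p i) * g ^ i)"
      using root by (simp add: poly_altdef)
    also have "\<dots> = (\<Sum>i<?n. k (Polynomial.coeff p i) * g ^ i) + g ^ ?n"
      using monic by (simp add: lessThan_Suc_atMost[symmetric])
    finally have "g ^ ?n = - (\<Sum>i<?n. k (Polynomial.coeff p i) * g ^ i)"
      by (simp add: eq_neg_iff_add_eq_0 add.commute)
    \<comment> \<open>The columns run through the coefficients from the highest degree down, hence
      the reversal of the sum.\<close>
    moreover have "(\<Sum>i<?n. k (Polynomial.coeff p i) * g ^ i)
        = (\<Sum>j<?n. k (Polynomial.coeff p (?n - Suc j)) * g ^ (?n - Suc j))"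
      by (rule sum.nat_diff_reindex[symmetric])
    moreover have "g ^ ?n = g * g ^ (?n - 1)"
      using r by (simp flip: power_Suc)
    ultimately have "- (\<Sum>j<?n. k (Polynomial.coeff p (?n - Suc j)) * g ^ (?n - Suc j))
        = g * g ^ (?n - 1)" by simp
    then show ?thesis
      using r True unfolding val
      by (simp add: generator_mat_def Let_def sum_negf k.hom_uminus)
  next
    case False
    have "(\<Sum>j<?n. k (generator_mat p $$ (r, j)) * g ^ (?n - 1 - j))
        = (\<Sum>j<?n. if j = r - 1 then g ^ (?n - 1 - j) else 0)"
      using r False by (intro sum.cong) (auto simp: generator_mat_def Let_def)
    also have "\<dots> = g ^ (?n - 1 - (r - 1))" using r by simp
    also have "?n - 1 - (r - 1) = Suc (?n - 1 - r)" using r False by simp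
    finally show ?thesis using r unfolding val by simp
  qed
qed (simp add: generator_mat_def Let_def)

text \<open>A relation among the powers of \<open>g\<close> is a system of coordinates of 0, and the
  zero sequence is the only such system.\<close>

lemma indep_entries_powers:
  fixes k :: "'f::{field,finite} \<Rightarrow> 'k::{field,finite}"
  assumes k: "field_hom k" and p: "irreducible p" "poly (map_poly k p) g = 0"
    and card: "CARD('k) = CARD('f) ^ degree p"
  shows "indep_entries k (degree p) (vec (degree p) (\<lambda>i. g ^ (degree p - 1 - i)))"
  unfolding indep_entries_def
proof (intro conjI ballI impI)
  interpret k: field_hom k by fact
  let ?n = "degree p"
  fix v assume v: "v \<in> carrier_vec ?n"
    and 0: "map_vec k v \<bullet> vec ?n (\<lambda>i. g ^ (?n - 1 - i)) = 0"
  \<comment> \<open>The entries of \<open>v\<close> in reverse order, since the powers descend,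
    continued by 0 as \<open>is_power_coords\<close> demands.\<close>
  define a where "a i = (if i < ?n then v $ (?n - Suc i) else 0)" for i
  have "0 = (\<Sum>j<?n. k (v $ j) * g ^ (?n - 1 - j))"
    using 0 v by (simp add: scalar_prod_def atLeast0LessThan)
  also have "\<dots> = (\<Sum>j<?n. k (a (?n - Suc j)) * g ^ (?n - Suc j))"
    by (rule sum.cong) (auto simp: a_def Suc_diff_Suc)
  also have "\<dots> = (\<Sum>i<?n. k (a i) * g ^ i)"
    by (rule sum.nat_diff_reindex)
  finally have "is_power_coords k ?n g 0 a"
    by (simp add: is_power_coords_def a_def)
  moreover have "is_power_coords k ?n g 0 (\<lambda>_. 0)"
    by (simp add: is_power_coords_def)
  ultimately have "a = (\<lambda>_. 0)"
    using power_coords_unique[OF k p(1) refl p(2) card, of 0] by blast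
  have "v $ j = 0" if "j < ?n" for j
  proof -
    have "v $ j = a (?n - Suc j)" using that by (simp add: a_def Suc_diff_Suc)
    then show ?thesis by (simp add: \<open>a = (\<lambda>_. 0)\<close>)
  qed
  then show "v = 0\<^sub>v ?n" using v by (intro eq_vecI) auto
qed simp

lemma field_elem_mat_eq_pow_comb:
  "field_elem_mat k p g x = pow_comb (degree p) (power_coords k (degree p) g x) (generator_mat p)"
  by (simp add: field_elem_mat_def pow_comb_def generator_mat_def Let_def)

section \<open>Powers of a primitive root of unity\<close>

lemma primitive_root_power_eq_1_iff:
  assumes "primitive_root_of_unity L b"
  shows "b ^ n = 1 \<longleftrightarrow> L dvd n"
proof
  have L: "0 < L" "b ^ L = 1" "\<And>k. 0 < k \<Longrightarrow> k < L \<Longrightarrow> b ^ k \<noteq> 1"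
    using assms by (auto simp: primitive_root_of_unity_def)
  assume "b ^ n = 1"
  moreover have "b ^ n = (b ^ L) ^ (n div L) * b ^ (n mod L)"
    by (simp flip: power_mult power_add)
  ultimately have "b ^ (n mod L) = 1" using L(2) by simp
  then show "L dvd n" using L by (metis bot_nat_0.not_eq_extremum mod_eq_0_iff_dvd mod_less_divisor)
next
  assume "L dvd n"
  then show "b ^ n = 1" using assms by (auto simp: primitive_root_of_unity_def power_mult)
qed

lemma primitive_root_nonzero: "primitive_root_of_unity L b \<Longrightarrow> b \<noteq> 0"
  by (auto simp: primitive_root_of_unity_def power_0_left)

lemma primitive_root_power_inj:
  assumes b: "primitive_root_of_unity L b" and "i < L" "j < L" and eq: "b ^ i = b ^ j"
  shows "i = j"
proof -
  \<comment> \<open>The ordered case suffices by symmetry and keeps \<open>j - i\<close> free of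
    truncation.\<close>
  have "i = j" if "i \<le> j" "j < L" "b ^ i = b ^ j" for i j
  proof -
    have "b ^ i * b ^ (j - i) = b ^ i * 1"
      using that by (metis le_add_diff_inverse mult.right_neutral power_add)
    then have "b ^ (j - i) = 1" using primitive_root_nonzero[OF b] by simp
    then have "L dvd j - i" using primitive_root_power_eq_1_iff[OF b] by simp
    then show "i = j" using that by (auto dest: dvd_imp_le)
  qed
  then show ?thesis using assms by (metis nat_le_linear)
qed

text \<open>If \<open>L\<close> divides \<open>l * k\<close>, coprimality moves the divisibility to
  \<open>k\<close>. This later separates the eigenvalues, which are powers of
  \<open>b ^ l\<close>.\<close>

lemma primitive_root_power_coprime:
  assumes b: "primitive_root_of_unity L b" and "coprime l L"
  shows "primitive_root_of_unity L (b ^ l)"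
proof -
  have "L dvd k" if "(b ^ l) ^ k = 1" for k
  proof -
    have "L dvd l * k"
      using that primitive_root_power_eq_1_iff[OF b, of "l * k"] by (simp add: power_mult)
    then show ?thesis
      using \<open>coprime l L\<close> by (simp add: coprime_dvd_mult_right_iff coprime_commute)
  qed
  then have "(b ^ l) ^ k \<noteq> 1" if "0 < k" "k < L" for k
    using that by (meson nat_dvd_not_less)
  moreover have "(b ^ l) ^ L = 1"
    using primitive_root_power_eq_1_iff[OF b, of "l * L"] by (simp add: power_mult)
  ultimately show ?thesis
    using b by (simp add: primitive_root_of_unity_def)
qed

section \<open>Diagonalization of the cyclic permutation matrix by the Fourier matrices\<close>

lemma cyclic_perm_mat_carrier: "0 < L \<Longrightarrow> cyclic_perm_mat L \<in> carrier_mat L L"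
  by (auto simp: cyclic_perm_mat_def)

lemma cyclic_perm_mat_index:
  assumes "i < L" "j < L"
  shows "cyclic_perm_mat L $$ (i, j) = (if j = Suc i mod L then 1 else 0)"
proof (cases "Suc i = L")
  case True
  then show ?thesis using assms by (auto simp: cyclic_perm_mat_def)
next
  case False
  then have "Suc i mod L = Suc i" using assms by simp
  then show ?thesis using assms False by (auto simp: cyclic_perm_mat_def)
qed

lemma (in field_hom) map_cyclic_perm_mat:
  "0 < L \<Longrightarrow> mat\<^sub>h (cyclic_perm_mat L) = cyclic_perm_mat L"
  using cyclic_perm_mat_carrier[where ?'a = 'a, of L] cyclic_perm_mat_carrier[where ?'a = 'b, of L]
  by (intro eq_matI) (auto simp: cyclic_perm_mat_index)

text \<open>Each factor replaces row \<open>i\<close> by row \<open>i + 1\<close>. The wrap-around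
  agrees with the formula because \<open>b ^ L = 1\<close>, so exponents need no reduction.\<close>

lemma cyclic_perm_mat_mult_fourier_mat:
  fixes b :: "'a::field"
  assumes L: "0 < L" and b: "b ^ L = 1"
  shows "cyclic_perm_mat L ^\<^sub>m l * fourier_mat L b = mat L L (\<lambda>(i, j). b ^ ((i + l) * j))"
proof -
  let ?X = "\<lambda>s. mat L L (\<lambda>(i, j). b ^ ((i + s) * j))"
  have C: "(cyclic_perm_mat L :: 'a mat) \<in> carrier_mat L L" using L by (rule cyclic_perm_mat_carrier)
  have step: "cyclic_perm_mat L * ?X s = ?X (Suc s)" for s
  proof (rule eq_matI)
    fix i j assume "i < dim_row (?X (Suc s))" "j < dim_col (?X (Suc s))"
    then have ij: "i < L" "j < L" by auto
    have per: "b ^ ((t mod L + s) * j) = b ^ ((t + s) * j)" for t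
    proof -
      have "b ^ ((t + s) * j) = b ^ (L * (t div L * j) + (t mod L + s) * j)"
        by (rule arg_cong[of _ _ "\<lambda>n. b ^ n"])
          (metis add.assoc distrib_right mult.assoc mult_div_mod_eq)
      also have "\<dots> = b ^ ((t mod L + s) * j)" using b by (simp add: power_add power_mult)
      finally show ?thesis ..
    qed
    have "(cyclic_perm_mat L * ?X s) $$ (i, j)
        = (\<Sum>k<L. (if k = Suc i mod L then 1 else 0) * b ^ ((k + s) * j))"
      using ij C by (simp add: scalar_prod_def atLeast0LessThan cyclic_perm_mat_index)
    also have "\<dots> = (\<Sum>k<L. if k = Suc i mod L then b ^ ((k + s) * j) else 0)"
      by (rule sum.cong) auto
    also have "\<dots> = b ^ ((Suc i mod L + s) * j)" using L by simp
    also have "\<dots> = ?X (Suc s) $$ (i, j)" using ij per[of "Suc i"] by simp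
    finally show "(cyclic_perm_mat L * ?X s) $$ (i, j) = ?X (Suc s) $$ (i, j)" .
  qed (use C in auto)
  \<comment> \<open>A matrix power gains its new factor on the right, next to \<open>?X s\<close>,
    so the induction must allow any initial shift \<open>s\<close>.\<close>
  have "cyclic_perm_mat L ^\<^sub>m l * ?X s = ?X (s + l)" for s
  proof (induction l arbitrary: s)
    case 0
    show ?case using C by simp
  next
    case (Suc l)
    have "cyclic_perm_mat L ^\<^sub>m Suc l * ?X s = cyclic_perm_mat L ^\<^sub>m l * (cyclic_perm_mat L * ?X s)"
      using C by (simp add: assoc_mult_mat[of _ L L _ L _ L])
    then show ?case by (simp only: step Suc.IH add_Suc_shift)
  qed
  from this[of 0] show ?thesis by (simp add: fourier_mat_def)
qed

text \<open>Orthogonality of the powers of \<open>b\<close>, by geometric sums. The Fourier matrices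
  are not normalized, so a factor \<open>L\<close> stays on the diagonal.\<close>

lemma fourier_mat_neg_cyclic_fourier_mat:
  fixes b :: "'a::field"
  assumes b: "primitive_root_of_unity L b"
  shows "fourier_mat_neg L b * (cyclic_perm_mat L ^\<^sub>m l * fourier_mat L b)
           = mat L L (\<lambda>(i, j). if i = j then of_nat L * b ^ (l * i) else 0)"
proof -
  have L: "0 < L" "b ^ L = 1" using b by (auto simp: primitive_root_of_unity_def)
  have b0: "b \<noteq> 0" using b by (rule primitive_root_nonzero)
  have ortho: "(\<Sum>t<L. (b ^ j / b ^ i) ^ t) = (if i = j then of_nat L else 0)"
    if "i < L" "j < L" for i j
  proof (cases "i = j")
    case False
    then have "b ^ j / b ^ i \<noteq> 1"
      using primitive_root_power_inj[OF b that] b0 by auto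
    moreover have "(b ^ j / b ^ i) ^ L = 1"
    proof -
      have "(b ^ t) ^ L = 1" for t
        using L(2) by (metis mult.commute power_mult power_one)
      then show ?thesis by (simp add: power_divide)
    qed
    ultimately show ?thesis using False by (simp add: geometric_sum)
  qed (use b0 in simp)
  show ?thesis
  proof (rule eq_matI)
    fix i j assume "i < dim_row (mat L L (\<lambda>(i, j). if i = j then of_nat L * b ^ (l * i) else 0))"
      "j < dim_col (mat L L (\<lambda>(i, j). if i = j then of_nat L * b ^ (l * i) else 0))"
    then have ij: "i < L" "j < L" by auto
    have "(fourier_mat_neg L b * (cyclic_perm_mat L ^\<^sub>m l * fourier_mat L b)) $$ (i, j)
        = (\<Sum>t<L. inverse (b ^ (i * t)) * b ^ ((t + l) * j))"
      using ij unfolding cyclic_perm_mat_mult_fourier_mat[OF L]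
      by (simp add: fourier_mat_neg_def scalar_prod_def atLeast0LessThan)
    also have "\<dots> = (\<Sum>t<L. b ^ (l * j) * (b ^ j / b ^ i) ^ t)"
      by (rule sum.cong)
        (simp_all add: power_divide divide_simps b0 algebra_simps flip: power_mult power_add)
    also have "\<dots> = b ^ (l * j) * (if i = j then of_nat L else 0)"
      using ortho[OF ij] by (simp flip: sum_distrib_left)
    finally show "(fourier_mat_neg L b * (cyclic_perm_mat L ^\<^sub>m l * fourier_mat L b)) $$ (i, j)
        = mat L L (\<lambda>(i, j). if i = j then of_nat L * b ^ (l * i) else 0) $$ (i, j)"
      using ij by simp
  next
    show "dim_col (fourier_mat_neg L b * (cyclic_perm_mat L ^\<^sub>m l * fourier_mat L b))
        = dim_col (mat L L (\<lambda>(i, j). if i = j then of_nat L * b ^ (l * i) else 0))"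
      unfolding cyclic_perm_mat_mult_fourier_mat[OF L] by simp
  qed (simp add: fourier_mat_neg_def)
qed

section \<open>Selected columns and their biorthogonality\<close>

lemma columns_at_carrier:
  assumes "A \<in> carrier_mat n L" "S \<subseteq> {..<L}"
  shows "columns_at A S \<in> carrier_mat n (card S)"
proof -
  have "{j. j < L \<and> j \<in> S} = S" using assms(2) by auto
  then show ?thesis
    using assms(1) by (intro carrier_matI) (simp_all add: columns_at_def dim_submatrix)
qed

lemma col_columns_at:
  assumes A: "A \<in> carrier_mat n L" and S: "S \<subseteq> {..<L}" and i: "i < card S"
  shows "col (columns_at A S) i = col A (pick S i)"
proof (rule eq_vecI)
  have SL: "{j. j < L \<and> j \<in> S} = S" using S by auto
  fix r assume "r < dim_vec (col A (pick S i))"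
  then have r: "r < n" using A by simp
  have "pick S i \<in> S" using i by (rule pick_in_set_le)
  then have "pick S i < L" using S by auto
  moreover have "col (columns_at A S) i $ r = columns_at A S $$ (r, i)"
    using columns_at_carrier[OF A S] r i by simp
  ultimately show "col (columns_at A S) i $ r = col A (pick S i) $ r"
    using A r i SL by (simp add: columns_at_def submatrix_index pick_UNIV)
qed (use columns_at_carrier[OF A S] A in simp)

text \<open>\<open>pick\<close> enumerates \<open>S\<close> increasingly, so the index of
  \<open>j\<close> is the number of smaller members.\<close>

lemma ex_pick:
  assumes "finite S" "j \<in> S"
  shows "\<exists>i<card S. pick S i = j"
  using assms pick_card_in_set[of j S]
  by (intro exI[of _ "card {a \<in> S. a < j}"]) (auto intro!: psubset_card_mono)

lemma col_zero_of_columns_at_zero: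
  assumes A: "A \<in> carrier_mat n L" and S: "S \<subseteq> {..<L}" and 0: "columns_at A S = 0\<^sub>m n (card S)"
    and j: "j \<in> S"
  shows "col A j = 0\<^sub>v n"
proof -
  obtain i where i: "i < card S" "pick S i = j"
    using ex_pick[OF finite_subset[OF S finite_lessThan] j] by blast
  then have "col A j = col (columns_at A S) i" using col_columns_at[OF A S] by simp
  then show ?thesis using 0 i by simp
qed

text \<open>The hypothesis on the inverse says that the transposed selection from \<open>U'\<close>
  times the selection from \<open>U\<close> is \<open>c\<close> times the identity; this is read
  entry by entry.\<close>

lemma columns_at_biorthogonal:
  fixes U :: "'a::field mat"
  assumes U: "U \<in> carrier_mat n L" and U': "U' \<in> carrier_mat n L"
    and S: "S \<subseteq> {..<L}" "card S = n"
    and rank: "vec_space.rank n (columns_at U S) = n"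
    and inv: "(columns_at U' S)\<^sup>T = c \<cdot>\<^sub>m inverse_mat (columns_at U S)"
    and jk: "j \<in> S" "k \<in> S"
  shows "col U' j \<bullet> col U k = (if j = k then c else 0)"
proof -
  have fin: "finite S" using S(1) by (rule finite_subset) simp
  obtain i where i: "i < card S" "pick S i = j" using ex_pick[OF fin jk(1)] by blast
  obtain i' where i': "i' < card S" "pick S i' = k" using ex_pick[OF fin jk(2)] by blast
  \<comment> \<open>\<open>pick\<close> is strictly increasing below \<open>card S\<close>, hence
    injective there.\<close>
  have ii': "i = i' \<longleftrightarrow> j = k" using i i' pick_mono_le[of _ S] by (metis nat_neq_iff)
  note U_S = columns_at_carrier[OF U S(1), unfolded S(2)]
  note U'_S = columns_at_carrier[OF U' S(1), unfolded S(2)]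
  note B = inverse_mat_full_rank[OF U_S rank]
  have "(columns_at U' S)\<^sup>T * columns_at U S = c \<cdot>\<^sub>m 1\<^sub>m n"
    using B U_S by (simp add: inv mult_smult_assoc_mat[of _ n n _ n])
  then have "((columns_at U' S)\<^sup>T * columns_at U S) $$ (i, i') = (if i = i' then c else 0)"
    using i i' S(2) by simp
  moreover have "((columns_at U' S)\<^sup>T * columns_at U S) $$ (i, i')
      = col (columns_at U' S) i \<bullet> col (columns_at U S) i'"
    using U_S U'_S i i' S(2) by simp
  ultimately show ?thesis
    using ii' i i' col_columns_at[OF U S(1)] col_columns_at[OF U' S(1)] by simp
qed

text \<open>Applied to column \<open>k\<close>, the product is a sum over all columns
  \<open>j\<close> of \<open>U\<close>. Biorthogonality removes each \<open>j\<close> in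
  \<open>S\<close> other than \<open>k\<close>, and the vanishing columns of \<open>U\<close> or
  \<open>U'\<close> remove each \<open>j\<close> outside \<open>S\<close>.\<close>

lemma diag_sandwich_eigenvector:
  fixes U :: "'a::field mat"
  assumes U: "U \<in> carrier_mat n L" and U': "U' \<in> carrier_mat n L"
    and S: "S \<subseteq> {..<L}" and k: "k \<in> S"
    and bi: "\<And>j. j \<in> S \<Longrightarrow> col U' j \<bullet> col U k = (if j = k then c else 0)"
    and off: "\<And>j. j \<in> {0..<L} - S \<Longrightarrow> col U j = 0\<^sub>v n \<or> col U' j = 0\<^sub>v n"
  shows "(U * mat L L (\<lambda>(i, j). if i = j then d i else 0) * U'\<^sup>T) *\<^sub>v col U k = (d k * c) \<cdot>\<^sub>v col U k"
proof -
  let ?D = "mat L L (\<lambda>(i, j). if i = j then d i else 0)"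
  have kL: "k < L" using S k by auto
  have uk: "col U k \<in> carrier_vec n" using U kL by auto
  have "(U * ?D * U'\<^sup>T) *\<^sub>v col U k = U *\<^sub>v (?D *\<^sub>v (U'\<^sup>T *\<^sub>v col U k))"
    using U U' uk by (simp add: assoc_mult_mat_vec[of _ n L] assoc_mult_mat_vec[of _ n L _ L])
  also have "?D *\<^sub>v (U'\<^sup>T *\<^sub>v col U k) = vec L (\<lambda>j. d j * (col U' j \<bullet> col U k))"
  proof (rule eq_vecI)
    fix j assume "j < dim_vec (vec L (\<lambda>j. d j * (col U' j \<bullet> col U k)))"
    then have j: "j < L" by simp
    have "(?D *\<^sub>v (U'\<^sup>T *\<^sub>v col U k)) $ j
        = (\<Sum>i<L. (if j = i then d j else 0) * (col U' i \<bullet> col U k))"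
      using U' j by (simp add: scalar_prod_def[of "row _ _"] scalar_prod_def[of "vec _ _"] atLeast0LessThan)
    also have "\<dots> = (\<Sum>i<L. if j = i then d j * (col U' j \<bullet> col U k) else 0)"
      by (rule sum.cong) auto
    finally show "(?D *\<^sub>v (U'\<^sup>T *\<^sub>v col U k)) $ j = vec L (\<lambda>j. d j * (col U' j \<bullet> col U k)) $ j"
      using j by simp
  qed simp
  also have "U *\<^sub>v vec L (\<lambda>j. d j * (col U' j \<bullet> col U k)) = (d k * c) \<cdot>\<^sub>v col U k"
  proof (rule eq_vecI)
    fix r assume "r < dim_vec ((d k * c) \<cdot>\<^sub>v col U k)"
    then have r: "r < n" using U by simp
    have summand: "U $$ (r, j) * (d j * (col U' j \<bullet> col U k)) = (if j = k then U $$ (r, k) * (d k * c) else 0)"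
      if j: "j < L" for j
    proof (cases "j \<in> S")
      case True
      then show ?thesis using bi by simp
    next
      case False
      then consider "col U j = 0\<^sub>v n" | "col U' j = 0\<^sub>v n" using off j by force
      then show ?thesis
      proof cases
        case 1
        then have "U $$ (r, j) = 0" using U r j by (metis carrier_matD index_col index_zero_vec(1))
        then show ?thesis using False k by auto
      next
        case 2
        then show ?thesis using False k uk by auto
      qed
    qed
    have "(U *\<^sub>v vec L (\<lambda>j. d j * (col U' j \<bullet> col U k))) $ r
        = (\<Sum>j<L. U $$ (r, j) * (d j * (col U' j \<bullet> col U k)))"
      using U r by (simp add: scalar_prod_def[of "row _ _"] atLeast0LessThan)
    also have "\<dots> = (\<Sum>j<L. if j = k then U $$ (r, k) * (d k * c) else 0)"
      by (intro sum.cong) (auto simp: summand)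
    also have "\<dots> = ((d k * c) \<cdot>\<^sub>v col U k) $ r" using U r kL by simp
    finally show "(U *\<^sub>v vec L (\<lambda>j. d j * (col U' j \<bullet> col U k))) $ r = ((d k * c) \<cdot>\<^sub>v col U k) $ r" .
  qed (use U in simp)
  finally show ?thesis .
qed

text \<open>The characteristic divides the prime \<open>q\<close> and is not 1, so it equals
  \<open>q\<close>, which does not divide \<open>L\<close>.\<close>

lemma of_nat_neq_0_if_coprime_CARD:
  assumes "prime q" "CARD('a::{field,finite}) = q" "coprime q L"
  shows "(of_nat L :: 'a) \<noteq> 0"
proof -
  have "CHAR('a) dvd q" using CHAR_dvd_CARD[where ?'a = 'a] assms(2) by simp
  then have "CHAR('a) = q"
    using assms(1) CHAR_not_1[where ?'a = 'a] by (auto simp: prime_nat_iff)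
  moreover have "\<not> q dvd L"
    using assms(1,3) by (metis coprime_absorb_left not_prime_unit)
  ultimately show ?thesis by (simp add: of_nat_eq_0_iff_char_dvd)
qed

section \<open>The contradiction from conjugacy to a field element\<close>

theorem lemma11:
  fixes \<iota> :: "'f::{field,finite} \<Rightarrow> 'e::{field,finite}"
    and \<kappa> :: "'f \<Rightarrow> 'k::{field,finite}"
    and q L m J :: nat
    and \<J> :: "nat set"
    and \<beta> :: 'e
    and U U' :: "'e mat"
    and G H :: "'f mat"
    and p :: "'f poly"
    and \<gamma> :: 'k
  assumes "prime q"
    and "0 < L"
    and "coprime q L"
    and "m = ord L q"
    and "\<J> = coprime_exponents L"
    and "J = card \<J>"
    and "m \<le> J"
    and "CARD('f) = q"
    and "CARD('e) = q ^ m"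
    and "CARD('k) = q ^ J"
    and "field_hom \<iota>"
    and "field_hom \<kappa>"
    and "primitive_root_of_unity L \<beta>"
    and "U \<in> carrier_mat J L"
    and "U' \<in> carrier_mat J L"
    and "vec_space.rank J (columns_at U \<J>) = J"
    and "(columns_at U' \<J>)\<^sup>T = inverse (\<iota> (of_nat L)) \<cdot>\<^sub>m inverse_mat (columns_at U \<J>)"
    and "columns_at U ({0..<L} - \<J>) = 0\<^sub>m J (L - J) \<or> columns_at U' ({0..<L} - \<J>) = 0\<^sub>m J (L - J)"
    and "map_mat \<iota> G = U * fourier_mat_neg L \<beta>"
    and "map_mat \<iota> H = fourier_mat L \<beta> * U'\<^sup>T"
    and "irreducible p"
    and "lead_coeff p = 1"
    and "degree p = J"
    and "poly (map_poly \<kappa> p) \<gamma> = 0"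
    and "J \<noteq> m"
  shows "\<forall>l\<in>\<J>. \<forall>\<beta>'::'k. \<forall>V\<in>carrier_mat J J. vec_space.rank J V = J \<longrightarrow>
           G * cyclic_perm_mat L ^\<^sub>m l * H \<noteq> V * field_elem_mat \<kappa> p \<gamma> \<beta>' * inverse_mat V"
proof (intro ballI allI impI notI)
  note q = assms(1) and cop = assms(3) and \<J> = assms(5) and cardJ = assms(6) and mJ = assms(7)
    and card_f = assms(8) and card_e = assms(9) and card_k = assms(10)
    and \<iota> = assms(11) and \<kappa> = assms(12) and \<beta> = assms(13) and U = assms(14) and U' = assms(15)
    and rank_U = assms(16) and inv_U = assms(17) and off = assms(18) and G = assms(19) and H = assms(20)
    and irr = assms(21) and monic = assms(22) and deg = assms(23) and root = assms(24) and ne = assms(25)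
  interpret \<iota>: field_hom \<iota> by (fact \<iota>)
  interpret \<kappa>: field_hom \<kappa> by (fact \<kappa>)
  fix l and \<beta>' :: 'k and V :: "'f mat"
  assume l: "l \<in> \<J>" and V: "V \<in> carrier_mat J J" and rank_V: "vec_space.rank J V = J"
  define M where "M = G * cyclic_perm_mat L ^\<^sub>m l * H"
  assume "G * cyclic_perm_mat L ^\<^sub>m l * H = V * field_elem_mat \<kappa> p \<gamma> \<beta>' * inverse_mat V"
  then have M_eq: "M = V * field_elem_mat \<kappa> p \<gamma> \<beta>' * inverse_mat V" by (simp add: M_def)
  have \<J>_sub: "\<J> \<subseteq> {..<L}" using \<open>0 < L\<close> by (auto simp: \<J> coprime_exponents_def)
  note C = pow_carrier_mat[OF cyclic_perm_mat_carrier[OF \<open>0 < L\<close>]]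
  have F: "fourier_mat L \<beta> \<in> carrier_mat L L" "fourier_mat_neg L \<beta> \<in> carrier_mat L L"
    by (simp_all add: fourier_mat_def fourier_mat_neg_def)
  \<comment> \<open>The dimensions of \<open>G\<close> and \<open>H\<close> are read off the
    factorizations of their images under \<open>\<iota>\<close>.\<close>
  have Gc: "G \<in> carrier_mat J L"
    using arg_cong[OF G, of dim_row] arg_cong[OF G, of dim_col] U F by (intro carrier_matI) auto
  have Hc: "H \<in> carrier_mat L J"
    using arg_cong[OF H, of dim_row] arg_cong[OF H, of dim_col] U' F by (intro carrier_matI) auto
  have Mc: "M \<in> carrier_mat J J"
    using mult_carrier_mat[OF mult_carrier_mat[OF Gc C] Hc] by (simp add: M_def)

  define A where "A = field_elem_mat \<kappa> p \<gamma> \<beta>'"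
  define w where "w = vec J (\<lambda>i. \<gamma> ^ (J - 1 - i))"
  have w: "indep_entries \<kappa> J w"
    using indep_entries_powers[OF \<kappa> irr root] card_f card_k deg by (simp add: w_def)
  then have wc: "w \<in> carrier_vec J" by (simp add: indep_entries_def)
  have gen: "generator_mat p \<in> carrier_mat J J"
    by (simp add: generator_mat_def Let_def deg)
  then have Ac: "A \<in> carrier_mat J J" by (simp add: A_def field_elem_mat_eq_pow_comb)
  have "map_mat \<kappa> (generator_mat p) *\<^sub>v w = \<gamma> \<cdot>\<^sub>v w"
    using generator_mat_eigenvector[OF \<kappa> monic root] by (simp add: w_def deg)
  from \<kappa>.pow_comb_eigenvector[OF gen wc this] obtain c where c: "map_mat \<kappa> A *\<^sub>v w = c \<cdot>\<^sub>v w"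
    unfolding A_def field_elem_mat_eq_pow_comb by blast
  note B = inverse_mat_full_rank[OF V rank_V]
  \<comment> \<open>Conjugacy becomes an intertwining relation, which carries the eigenvector
    \<open>w\<close> of \<open>A\<close> to the eigenvector \<open>V w\<close> of
    \<open>M\<close>.\<close>
  have "M * V = V * A"
    using V Ac B by (simp add: M_eq A_def[symmetric] assoc_mult_mat[of _ J J _ J _ J])
  then have "map_mat \<kappa> M * map_mat \<kappa> V = map_mat \<kappa> V * map_mat \<kappa> A"
    using \<kappa>.mat_hom_mult[OF Mc V] \<kappa>.mat_hom_mult[OF V Ac] by simp
  then have "(map_mat \<kappa> M * map_mat \<kappa> V) *\<^sub>v w = (map_mat \<kappa> V * map_mat \<kappa> A) *\<^sub>v w"
    by (rule arg_cong)
  then have "map_mat \<kappa> M *\<^sub>v (map_mat \<kappa> V *\<^sub>v w) = map_mat \<kappa> V *\<^sub>v (map_mat \<kappa> A *\<^sub>v w)"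
    using Mc V Ac wc by (simp add: assoc_mult_mat_vec[of _ J J _ J])
  then have Mw: "map_mat \<kappa> M *\<^sub>v (map_mat \<kappa> V *\<^sub>v w) = c \<cdot>\<^sub>v (map_mat \<kappa> V *\<^sub>v w)"
    using V wc c by (simp add: mult_mat_vec[of _ J J])

  have L0: "\<iota> (of_nat L) \<noteq> 0"
    using of_nat_neq_0_if_coprime_CARD[OF q card_f cop] by simp
  let ?D = "mat L L (\<lambda>(i, j). if i = j then of_nat L * \<beta> ^ (l * i) else 0)"
  have "map_mat \<iota> M = map_mat \<iota> G * cyclic_perm_mat L ^\<^sub>m l * map_mat \<iota> H"
    using \<iota>.mat_hom_mult[OF mult_carrier_mat[OF Gc C] Hc] \<iota>.mat_hom_mult[OF Gc C]
      \<iota>.mat_hom_pow[OF cyclic_perm_mat_carrier] \<open>0 < L\<close>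
    by (simp add: M_def \<iota>.map_cyclic_perm_mat)
  also have "\<dots> = U * (fourier_mat_neg L \<beta> * (cyclic_perm_mat L ^\<^sub>m l * fourier_mat L \<beta>)) * U'\<^sup>T"
  proof -
    let ?T = "U'\<^sup>T" and ?C = "cyclic_perm_mat L ^\<^sub>m l :: 'e mat"
      and ?F = "fourier_mat L \<beta>" and ?N = "fourier_mat_neg L \<beta>"
    have T: "?T \<in> carrier_mat L J" using U' by simp
    have "U * ?N * ?C * (?F * ?T) = U * ?N * ?C * ?F * ?T"
      using assoc_mult_mat[OF mult_carrier_mat[OF mult_carrier_mat[OF U F(2)] C] F(1) T] by simp
    also have "U * ?N * ?C * ?F = U * ?N * (?C * ?F)"
      by (rule assoc_mult_mat[OF mult_carrier_mat[OF U F(2)] C F(1)])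
    also have "\<dots> = U * (?N * (?C * ?F))"
      by (rule assoc_mult_mat[OF U F(2) mult_carrier_mat[OF C F(1)]])
    finally show ?thesis by (simp only: G H)
  qed
  finally have M_diag: "map_mat \<iota> M = U * ?D * U'\<^sup>T"
    by (simp add: fourier_mat_neg_cyclic_fourier_mat[OF \<beta>])
  have bi: "col U' j \<bullet> col U k = (if j = k then inverse (\<iota> (of_nat L)) else 0)"
    if "j \<in> \<J>" "k \<in> \<J>" for j k
    using columns_at_biorthogonal[OF U U' \<J>_sub cardJ[symmetric] rank_U inv_U that] .
  \<comment> \<open>This matches the width \<open>L - J\<close> of the zero matrix in the hypothesis
    with the cardinality in \<open>col_zero_of_columns_at_zero\<close>.\<close>
  have "card ({0..<L} - \<J>) = L - J"
    using \<J>_sub by (simp add: card_Diff_subset finite_subset[OF \<J>_sub] cardJ atLeast0LessThan)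
  moreover have "{0..<L} - \<J> \<subseteq> {..<L}" by auto
  ultimately have zero: "col U j = 0\<^sub>v J \<or> col U' j = 0\<^sub>v J" if "j \<in> {0..<L} - \<J>" for j
    using off that col_zero_of_columns_at_zero[OF U, of "{0..<L} - \<J>"]
      col_zero_of_columns_at_zero[OF U', of "{0..<L} - \<J>"] by auto
  have "eigenvalue (map_mat \<iota> M) (\<beta> ^ (l * k))" if k: "k \<in> \<J>" for k
    unfolding eigenvalue_def eigenvector_def
  proof (intro exI conjI)
    have kL: "k < L" using \<J>_sub k by auto
    show "col U k \<in> carrier_vec (dim_row (map_mat \<iota> M))" using U Mc kL by auto
    \<comment> \<open>A nonzero scalar product shows that the eigenvector is nonzero.\<close>
    have "col U' k \<bullet> col U k \<noteq> 0" using bi[OF k k] L0 by simp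
    moreover have "col U' k \<in> carrier_vec J" using U' kL by auto
    ultimately show "col U k \<noteq> 0\<^sub>v (dim_row (map_mat \<iota> M))" using Mc by auto
    \<comment> \<open>The factor \<open>L\<close> of the diagonal entries cancels against the
      inverse of \<open>L\<close> from biorthogonality.\<close>
    show "map_mat \<iota> M *\<^sub>v col U k = \<beta> ^ (l * k) \<cdot>\<^sub>v col U k"
      using diag_sandwich_eigenvector[OF U U' \<J>_sub k bi[OF _ k] zero,
          where d = "\<lambda>i. of_nat L * \<beta> ^ (l * i)"]
        L0 \<iota>.hom_of_nat[of L]
      by (simp add: M_diag field_simps del: \<iota>.hom_of_nat)
  qed
  then have "card ((\<lambda>k. \<beta> ^ (l * k)) ` \<J>) \<le> m"
    using card_e card_f
    by (intro card_eigenvalues_le[OF \<iota> \<kappa> _ Mc \<kappa>.indep_entries_mult[OF V B(1,3) w] Mw]) auto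
  \<comment> \<open>Distinct members of \<open>\<J>\<close> give distinct eigenvalues, so the bound
    \<open>m\<close> applies to \<open>J\<close> itself.\<close>
  moreover have "inj_on (\<lambda>k. \<beta> ^ (l * k)) \<J>"
  proof (rule inj_onI)
    fix i j assume ij: "i \<in> \<J>" "j \<in> \<J>" "\<beta> ^ (l * i) = \<beta> ^ (l * j)"
    have "coprime l L" using l by (simp add: \<J> coprime_exponents_def)
    from primitive_root_power_inj[OF primitive_root_power_coprime[OF \<beta> this], of i j]
    show "i = j" using ij \<J>_sub by (auto simp: power_mult)
  qed
  ultimately have "J \<le> m" by (simp add: card_image cardJ)
  then show False using mJ ne by simp
qed

end
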